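(* Let $U\subseteq\mathbb{R}^d$ be a $k$-dimensional linear subspace, let $x\in U$, and let $s\in[d]$. A set $S$ is drawn uniformly at random from $\binom{[d]}{s}$, and an adversary (who may depend on $U$, $x$ and $S$) produces a vector $\tilde x\in\mathbb{R}^d$ such that $\tilde x_i=x_i$ for every $i\in[d]\setminus S$ and $\|\tilde x-x\|_\infty\le 1$. Let $x^*$ be any optimal solution of the Basis Pursuit program \[\text{minimize } \|\hat x-\tilde x\|_1 \quad\text{subject to } \hat x\in U.\] Then for every $t>0$, over the randomness of $S$, the probability $\Pr[\|x^*-x\|_1\ge t]$ is upper bounded by both \[\frac{1}{(\lfloor t/4\rfloor+1)!}\left(\frac{12s^2k}{d}\right)^{\lfloor t/4\rfloor+1}\qquad\text{and}\qquad \frac{24ks}{d}.\] Furthermore, if $s\le\sqrt{d/2}$, this probability is also upper bounded by \[12k\left(\frac{2s}{d}\right)^{1+\lfloor t/(48k)\rfloor}.\]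
   Context: $[d]=\{1,\dots,d\}$ and $\binom{[d]}{s}$ denotes the family of all size-$s$ subsets of $[d]$. *)

theory Defs
  imports "HOL-Probability.Probability"
begin

definition l1_norm :: "real ^ 'n \<Rightarrow> real" where
  "l1_norm v = (\<Sum>i\<in>UNIV. \<bar>v $ i\<bar>)"

definition corruption :: "'n set \<Rightarrow> real ^ 'n \<Rightarrow> real ^ 'n \<Rightarrow> bool" where
  "corruption S x y \<longleftrightarrow> (\<forall>i. i \<notin> S \<longrightarrow> y $ i = x $ i) \<and> infnorm (y - x) \<le> 1"

definition basis_pursuit_solution :: "(real ^ 'n) set \<Rightarrow> real ^ 'n \<Rightarrow> real ^ 'n \<Rightarrow> bool" where
  "basis_pursuit_solution U y z \<longleftrightarrow> z \<in> U \<and> (\<forall>w\<in>U. l1_norm (z - y) \<le> l1_norm (w - y))"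

definition size_subsets :: "nat \<Rightarrow> 'n::finite set set" where
  "size_subsets s = {S. card S = s}"

end

theory Submission
  imports Defs
begin

text \<open>
  Auerbach's lemma, obtained by maximising a determinant, gives weights \<open>w\<close> of total mass at most
  \<open>k\<close> with \<open>\<bar>v\<^sub>j\<bar> \<le> w\<^sub>j \<parallel>v\<parallel>\<^sub>1\<close> for all \<open>v \<in> U\<close>. Optimality of \<open>x\<^sup>*\<close> gives, with \<open>L = \<parallel>x\<^sup>* - x\<parallel>\<^sub>1\<close>,
  \<open>L \<le> 2 (\<Sum>i\<in>S. min 1 (w\<^sub>i L))\<close>. In particular \<open>S\<close> has weight at least \<open>1 / 2\<close>, and Markov's
  inequality yields the second bound. Moreover, if \<open>T = \<lfloor>t / 4\<rfloor>\<close> and the numbers \<open>a\<^sub>r\<close>, \<open>T < r \<le> s\<close>,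
  have sum at most \<open>1 / 4\<close>, then \<open>L \<ge> t\<close> forces \<open>S\<close> to contain, for some such \<open>r\<close>, at least \<open>r\<close> of
  the at most \<open>k / a\<^sub>r\<close> coordinates of weight at least \<open>a\<^sub>r\<close>. A union bound over \<open>r\<close>-subsets with
  \<open>a\<^sub>r = 1 / (4 s)\<close> gives the first bound, and with \<open>a\<^sub>r = T / (4 r\<^sup>2)\<close> the third one.
\<close>

section \<open>Coordinate weights for a subspace, via compactness and determinants\<close>

lemma l1_norm_nonneg: "0 \<le> l1_norm v"
  by (simp add: l1_norm_def sum_nonneg)

lemma l1_norm_eq_0_iff: "l1_norm v = 0 \<longleftrightarrow> v = 0"
  by (simp add: l1_norm_def sum_nonneg_eq_0_iff vec_eq_iff)

lemma l1_norm_scaleR: "l1_norm (c *\<^sub>R v) = \<bar>c\<bar> * l1_norm v"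
  by (simp add: l1_norm_def abs_mult sum_distrib_left)

lemma continuous_on_det: "continuous_on A (det :: real^'n^'n \<Rightarrow> real)"
  unfolding det_def by (intro continuous_intros)

lemma compact_l1_unit_ball_subspace:
  fixes U :: "(real^'n) set"
  assumes "subspace U"
  shows "compact {v \<in> U. l1_norm v \<le> 1}"
proof -
  have "continuous_on UNIV (l1_norm :: real^'n \<Rightarrow> real)"
    unfolding l1_norm_def by (intro continuous_intros)
  then have "closed {v :: real^'n. l1_norm v \<le> 1}"
    by (intro closed_Collect_le) auto
  then have "closed (U \<inter> {v. l1_norm v \<le> 1})"
    using closed_subspace[OF assms] by blast
  moreover have "norm v \<le> l1_norm v" for v :: "real^'n"
    by (simp add: l1_norm_def norm_le_l1_cart)
  then have "bounded (U \<inter> {v. l1_norm v \<le> 1})"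
    by (intro boundedI[of _ 1]) (auto intro: order_trans)
  ultimately show ?thesis
    by (simp add: compact_eq_bounded_closed Int_def)
qed

text \<open>Serves to make \<open>\<bar>det A\<bar>\<close> attain its maximum when each row is
  confined to a compact set of its own.\<close>

lemma compact_rows:
  fixes K :: "'m::finite \<Rightarrow> (real^'n) set"
  assumes "\<And>i. compact (K i)"
  shows "compact {A :: real^'n^'m. \<forall>i. A $ i \<in> K i}"
proof -
  have "bounded {A :: real^'n^'m. \<forall>i. A $ i \<in> K i}"
  proof -
    have "\<forall>i. \<exists>b. \<forall>v\<in>K i. norm v \<le> b"
      using assms compact_imp_bounded bounded_iff by metis
    then obtain b where b: "\<And>i v. v \<in> K i \<Longrightarrow> norm v \<le> b i" by metis
    have "norm A \<le> sum b UNIV" if "\<forall>i. A $ i \<in> K i" for A :: "real^'n^'m"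
    proof -
      have "norm A \<le> (\<Sum>i\<in>UNIV. norm (A $ i))"
        unfolding norm_vec_def by (rule L2_set_le_sum) simp
      also have "\<dots> \<le> sum b UNIV"
        using that b by (intro sum_mono) auto
      finally show ?thesis .
    qed
    then show ?thesis by (intro boundedI) auto
  qed
  moreover have "closed {A :: real^'n^'m. \<forall>i. A $ i \<in> K i}"
  proof -
    have "closed ((\<lambda>A. A $ i) -` K i :: (real^'n^'m) set)" for i
      by (intro closed_vimage compact_imp_closed assms continuous_intros)
    then have "closed (\<Inter>i. (\<lambda>A. A $ i) -` K i :: (real^'n^'m) set)" by blast
    also have "(\<Inter>i. (\<lambda>A. A $ i) -` K i :: (real^'n^'m) set) = {A. \<forall>i. A $ i \<in> K i}"
      by auto
    finally show ?thesis .
  qed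
  ultimately show ?thesis by (simp add: compact_eq_bounded_closed)
qed

lemma det_nonzero_iff_span_rows:
  fixes A :: "real^'n^'n"
  shows "det A \<noteq> 0 \<longleftrightarrow> span (rows A) = UNIV"
  using matrix_left_invertible_span_rows[of A] invertible_left_inverse[of A] invertible_det_nz[of A]
  by simp

text \<open>A spanning set has at least as many elements as the dimension, so the rows can neither
  be dependent nor coincide. Injectivity is recorded separately because \<open>rows A\<close> is a
  set and forgets repetitions.\<close>

lemma det_nonzero_imp_rows_independent:
  fixes A :: "real^'n^'n"
  assumes "det A \<noteq> 0"
  shows "independent (rows A)" and "inj (\<lambda>i. A $ i)"
proof -
  have rows: "rows A = range (\<lambda>i. A $ i)"
    by (auto simp: rows_def row_def vec_nth_inverse)
  have sp: "span (rows A) = UNIV"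
    using assms det_nonzero_iff_span_rows by blast
  have le: "card (rows A) \<le> CARD('n)"
    unfolding rows by (rule card_image_le) simp
  show ind: "independent (rows A)"
    by (rule card_le_dim_spanning[of _ UNIV]) (use sp le in \<open>auto simp: rows\<close>)
  have "card (rows A) = CARD('n)"
    using dim_eq_card[of "rows A" UNIV] sp ind by simp
  then show "inj (\<lambda>i. A $ i)"
    unfolding rows by (intro eq_card_imp_inj_on) auto
qed

text \<open>For rows spanning \<open>U\<close> that maximise the determinant over the unit ball,
  Cramer's rule bounds every coefficient of \<open>v\<close> by \<open>l1_norm v\<close>. Summing
  absolute entries down each column of these rows then gives the weights, whose total is the sum of
  the row norms.\<close>

lemma sensitivity_bound:
  fixes U :: "(real^'n) set"
  assumes U: "subspace U"
  obtains w :: "'n \<Rightarrow> real"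
  where "\<And>j. 0 \<le> w j" and "sum w UNIV \<le> real (dim U)"
    and "\<And>v j. v \<in> U \<Longrightarrow> \<bar>v $ j\<bar> \<le> w j * l1_norm v"
proof -
  obtain B where B: "B \<subseteq> U" "independent B" "U \<subseteq> span B" "card B = dim U"
    using basis_exists by blast
  obtain C where C: "B \<subseteq> C" "independent C" "UNIV \<subseteq> span C"
    using maximal_independent_subset_extend[of B UNIV] B(2) by auto
  have "card C = CARD('n)"
    using dim_eq_card[of C UNIV] C(2) top.extremum_uniqueI[OF C(3)] by simp
  moreover have finC: "finite C" using C(2) finiteI_independent by blast
  ultimately obtain f where f: "bij_betw f (UNIV :: 'n set) C"
    using finite_same_card_bij[of "UNIV :: 'n set" C] by auto
  define I where "I = {i. f i \<in> B}"
  have "f ` I = B"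
    using f C(1) by (auto simp: I_def bij_betw_def)
  moreover have "inj f" using f by (simp add: bij_betw_def)
  ultimately have cardI: "card I = dim U"
    using card_image[of f I] B(4) by (simp add: inj_on_subset)
  \<comment> \<open>Only the rows in \<open>I\<close> vary; the others are frozen at basis vectors
    completing \<open>B\<close>, so that a full-size determinant measures volume inside
    \<open>U\<close>.\<close>
  define K where "K i = (if i \<in> I then {v \<in> U. l1_norm v \<le> 1} else {f i})" for i
  define M where "M = {A :: real^'n^'n. \<forall>i. A $ i \<in> K i}"
  have "compact M"
    unfolding M_def by (rule compact_rows) (simp add: K_def compact_l1_unit_ball_subspace[OF U])
  \<comment> \<open>Scaling the basis of \<open>U\<close> to norm 1 gives a feasible matrix
    \<open>A0\<close> with nonzero determinant, hence the maximum is nonzero too.\<close>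
  define c where "c i = (if i \<in> I then inverse (l1_norm (f i)) else 1)" for i
  define A0 :: "real^'n^'n" where "A0 = (\<chi> i. c i *s f i)"
  have f_nz: "f i \<noteq> 0" for i
    using f C(2) dependent_zero by (metis bij_betwE UNIV_I)
  then have f_pos: "l1_norm (f i) \<noteq> 0" for i
    by (simp add: l1_norm_eq_0_iff)
  have A0M: "A0 \<in> M"
    using f_pos B(1) subspace_scale[OF U]
    by (auto simp: M_def A0_def K_def c_def I_def l1_norm_scaleR scalar_mult_eq_scaleR l1_norm_nonneg)
  have detA0: "det A0 \<noteq> 0"
  proof -
    have "rows (\<chi> i. f i) = C"
      using f by (auto simp: rows_def row_def vec_nth_inverse bij_betw_def)
    then have "det (\<chi> i. f i) \<noteq> 0"
      using C(3) det_nonzero_iff_span_rows by auto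
    moreover have "prod c UNIV \<noteq> 0"
      by (auto simp: c_def f_pos)
    ultimately show ?thesis
      by (simp add: A0_def det_rows_mul)
  qed
  have "continuous_on M (\<lambda>A. \<bar>det A\<bar>)"
    by (intro continuous_intros continuous_on_det)
  then obtain A where AM: "A \<in> M" and max: "\<And>A'. A' \<in> M \<Longrightarrow> \<bar>det A'\<bar> \<le> \<bar>det A\<bar>"
    using continuous_attains_sup[OF \<open>compact M\<close>, of "\<lambda>A. \<bar>det A\<bar>"] A0M by blast
  have detA: "det A \<noteq> 0"
    using max[OF A0M] detA0 by auto
  note ind = det_nonzero_imp_rows_independent[OF detA]
  have row: "row i A = A $ i" for i
    by (simp add: row_def vec_nth_inverse)
  have AU: "A $ i \<in> U" "l1_norm (A $ i) \<le> 1" if "i \<in> I" for i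
    using AM that by (auto simp: M_def K_def split: if_splits dest!: spec[of _ i])
  have U_span: "U \<subseteq> span ((\<lambda>i. A $ i) ` I)"
  proof (rule card_ge_dim_independent)
    show "independent ((\<lambda>i. A $ i) ` I)"
      using ind(1) by (rule independent_mono) (auto simp: rows_def row)
    show "dim U \<le> card ((\<lambda>i. A $ i) ` I)"
      using ind(2) cardI by (simp add: card_image inj_on_subset)
  qed (use AU in auto)
  have coeff: "\<exists>\<alpha>. v = (\<Sum>i\<in>I. \<alpha> i *\<^sub>R A $ i) \<and> (\<forall>i\<in>I. \<bar>\<alpha> i\<bar> \<le> l1_norm v)" if v: "v \<in> U" for v
  proof -
    have "v \<in> span ((\<lambda>i. A $ i) ` I)"
      using v U_span by blast
    then obtain g where "v = (\<Sum>b\<in>(\<lambda>i. A $ i) ` I. g b *\<^sub>R b)"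
      by (auto simp: span_finite)
    then have vI: "v = (\<Sum>i\<in>I. g (A $ i) *\<^sub>R A $ i)"
      using ind(2) by (simp add: sum.reindex inj_on_subset o_def)
    \<comment> \<open>The coefficients are padded by 0 outside \<open>I\<close>, since Cramer's rule
      needs a combination of all rows.\<close>
    define y :: "real^'n" where "y = (\<chi> i. if i \<in> I then g (A $ i) else 0)"
    have vy: "v = (\<Sum>i\<in>UNIV. y $ i *s row i A)"
      unfolding vI by (rule sum.mono_neutral_cong_left)
        (auto simp: y_def row scalar_mult_eq_scaleR)
    have "\<bar>y $ i\<bar> \<le> l1_norm v" if i: "i \<in> I" for i
    proof (cases "v = 0")
      \<comment> \<open>Normalising \<open>v\<close> is impossible here; instead Cramer's
        determinant has a zero row, which forces \<open>y $ i = 0\<close>.\<close>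
      case True
      have "y $ i * det A = det (\<chi> j. if j = i then v else row j A)"
        unfolding vy by (rule cramer_lemma_transpose[symmetric])
      also have "\<dots> = 0"
        by (rule det_zero_row(1)[of i]) (simp add: row_def True zero_vec_def)
      finally show ?thesis using detA True l1_norm_nonneg by simp
    next
      case False
      define N where "N = l1_norm v"
      have N: "N > 0" using False l1_norm_nonneg[of v] l1_norm_eq_0_iff[of v] by (simp add: N_def)
      have sc: "inverse N *\<^sub>R v = (\<Sum>j\<in>UNIV. (inverse N *\<^sub>R y) $ j *s row j A)"
        unfolding vy by (simp add: scaleR_sum_right scalar_mult_eq_scaleR)
      \<comment> \<open>Replacing row \<open>i\<close> by the normalised vector stays feasible and
        multiplies the determinant by \<open>y $ i / N\<close>; maximality makes this factor at most
        1 in absolute value.\<close>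
      define A' where "A' = (\<chi> j. if j = i then inverse N *\<^sub>R v else row j A)"
      have "inverse N *\<^sub>R v \<in> K i"
        using i v N subspace_scale[OF U] by (simp add: K_def l1_norm_scaleR flip: N_def)
      then have "A' \<in> M"
        using AM by (auto simp: A'_def M_def row)
      then have "\<bar>det A'\<bar> \<le> \<bar>det A\<bar>" by (rule max)
      also have "det A' = (inverse N *\<^sub>R y) $ i * det A"
        unfolding A'_def sc by (rule cramer_lemma_transpose)
      finally have "\<bar>inverse N * y $ i\<bar> \<le> 1"
        using detA by (simp add: abs_mult)
      then show ?thesis
        using N by (simp add: abs_mult N_def[symmetric] field_simps)
    qed
    then show ?thesis
      using vI by (intro exI[of _ "\<lambda>i. g (A $ i)"]) (auto simp: y_def)
  qed
  show ?thesis
  proof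
    let ?w = "\<lambda>j. \<Sum>i\<in>I. \<bar>A $ i $ j\<bar>"
    show "0 \<le> ?w j" for j by (simp add: sum_nonneg)
    have "sum ?w UNIV = (\<Sum>i\<in>I. l1_norm (A $ i))"
      unfolding l1_norm_def by (rule sum.swap)
    also have "\<dots> \<le> (\<Sum>i\<in>I. 1)"
      using AU by (intro sum_mono) auto
    finally show "sum ?w UNIV \<le> real (dim U)" using cardI by simp
    show "\<bar>v $ j\<bar> \<le> ?w j * l1_norm v" if "v \<in> U" for v j
    proof -
      obtain \<alpha> where \<alpha>: "v = (\<Sum>i\<in>I. \<alpha> i *\<^sub>R A $ i)" "\<And>i. i \<in> I \<Longrightarrow> \<bar>\<alpha> i\<bar> \<le> l1_norm v"
        using coeff[OF \<open>v \<in> U\<close>] by blast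
      have "\<bar>v $ j\<bar> = \<bar>\<Sum>i\<in>I. \<alpha> i * A $ i $ j\<bar>"
        by (subst \<alpha>(1)) simp
      also have "\<dots> \<le> (\<Sum>i\<in>I. \<bar>\<alpha> i * A $ i $ j\<bar>)" by (rule sum_abs)
      also have "\<dots> \<le> (\<Sum>i\<in>I. \<bar>A $ i $ j\<bar> * l1_norm v)"
        using \<alpha>(2) by (intro sum_mono) (simp add: abs_mult mult.commute[of "\<bar>A $ _ $ j\<bar>"] mult_right_mono)
      finally show ?thesis by (simp add: sum_distrib_right)
    qed
  qed
qed

section \<open>Deterministic consequences of optimality\<close>

lemma l1_norm_error_le:
  assumes "corruption S x y" and "basis_pursuit_solution U y z" and "x \<in> U"
  shows "l1_norm (z - x) \<le> 2 * (\<Sum>i\<in>S. min 1 \<bar>(z - x) $ i\<bar>)"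
proof -
  have e: "\<bar>y $ i - x $ i\<bar> \<le> 1" for i
    using component_le_infnorm_cart[of "y - x" i] assms(1) by (simp add: corruption_def)
  have off: "y $ i = x $ i" if "i \<notin> S" for i
    using assms(1) that by (simp add: corruption_def)
  \<comment> \<open>Since \<open>x\<close> is feasible, the added difference
    \<open>l1_norm (x - y) - l1_norm (z - y)\<close> is nonnegative.\<close>
  have "l1_norm (z - x) \<le> l1_norm (z - x) + l1_norm (x - y) - l1_norm (z - y)"
    using assms(2,3) by (simp add: basis_pursuit_solution_def)
  also have "\<dots> = (\<Sum>i\<in>UNIV. \<bar>z $ i - x $ i\<bar> + \<bar>x $ i - y $ i\<bar> - \<bar>z $ i - y $ i\<bar>)"
    by (simp add: l1_norm_def sum.distrib sum_subtractf)
  \<comment> \<open>Off \<open>S\<close> the two terms in \<open>z\<close> cancel and the third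
    vanishes. On \<open>S\<close> the triangle inequality leaves at most twice the smaller of
    \<open>\<bar>z $ i - x $ i\<bar>\<close> and \<open>\<bar>x $ i - y $ i\<bar>\<close>, and the
    latter is at most 1.\<close>
  also have "\<dots> \<le> (\<Sum>i\<in>UNIV. if i \<in> S then 2 * min 1 \<bar>(z - x) $ i\<bar> else 0)"
  proof (rule sum_mono)
    fix i
    show "\<bar>z $ i - x $ i\<bar> + \<bar>x $ i - y $ i\<bar> - \<bar>z $ i - y $ i\<bar>
        \<le> (if i \<in> S then 2 * min 1 \<bar>(z - x) $ i\<bar> else 0)"
      using e[of i] off[of i] by (auto simp: min_def)
  qed
  also have "\<dots> = 2 * (\<Sum>i\<in>S. min 1 \<bar>(z - x) $ i\<bar>)"
    by (simp add: sum.If_cases sum_distrib_left)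
  finally show ?thesis .
qed

lemma finite_decreasing_enumeration:
  fixes w :: "'a \<Rightarrow> real"
  assumes "finite S"
  obtains f where "bij_betw f {..<card S} S"
    and "\<And>i j. i \<le> j \<Longrightarrow> j < card S \<Longrightarrow> w (f j) \<le> w (f i)"
proof -
  obtain xs where xs: "set xs = S" "distinct xs"
    using finite_distinct_list[OF assms] by blast
  define ys where "ys = sort_key (\<lambda>a. - w a) xs"
  have ys: "set ys = S" "distinct ys" "sorted (map (\<lambda>a. - w a) ys)"
    using xs by (simp_all add: ys_def)
  then have len: "length ys = card S"
    using distinct_card by fastforce
  show ?thesis
  proof
    show "bij_betw ((!) ys) {..<card S} S"
      using bij_betw_nth[OF ys(2)] ys(1) len by auto
    show "w (ys ! j) \<le> w (ys ! i)" if "i \<le> j" "j < card S" for i j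
      using sorted_nth_mono[OF ys(3), of i j] that len by simp
  qed
qed

text \<open>At most \<open>T \<le> L / 4\<close> of the summands, those of largest weight, are estimated by \<open>1\<close>; the
  remaining elements of \<open>S\<close> must then carry total weight at least \<open>1 / 4\<close>.\<close>

lemma exists_heavy_level:
  fixes w :: "'a \<Rightarrow> real" and a :: "nat \<Rightarrow> real"
  assumes "finite S" and "L > 0" and "real T \<le> L / 4"
    and "L \<le> 2 * (\<Sum>i\<in>S. min 1 (w i * L))"
    and "(\<Sum>r\<in>{T<..card S}. a r) \<le> 1 / 4"
  shows "\<exists>r\<in>{T<..card S}. r \<le> card (S \<inter> {i. a r \<le> w i})"
proof (rule ccontr)
  assume neg: "\<not> ?thesis"
  obtain f where f: "bij_betw f {..<card S} S"
    and mono: "\<And>i j. i \<le> j \<Longrightarrow> j < card S \<Longrightarrow> w (f j) \<le> w (f i)"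
    using finite_decreasing_enumeration[OF assms(1), of w] by blast
  \<comment> \<open>The enumeration starts at 0: a large \<open>w (f j)\<close> would put the
    \<open>Suc j\<close> elements \<open>f 0\<close> to \<open>f j\<close> above the threshold of
    level \<open>Suc j\<close>.\<close>
  have small: "w (f j) < a (Suc j)" if "T \<le> j" "j < card S" for j
  proof (rule ccontr)
    assume "\<not> w (f j) < a (Suc j)"
    then have "f ` {..j} \<subseteq> S \<inter> {i. a (Suc j) \<le> w i}"
      using mono[of _ j] that f by (fastforce simp: bij_betw_def)
    moreover have "inj_on f {..j}"
      using f that by (auto simp: bij_betw_def intro: inj_on_subset)
    then have "card (f ` {..j}) = Suc j"
      by (simp add: card_image)
    ultimately have "Suc j \<le> card (S \<inter> {i. a (Suc j) \<le> w i})"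
      using card_mono[of "S \<inter> {i. a (Suc j) \<le> w i}" "f ` {..j}"] assms(1) by simp
    then show False using neg that by auto
  qed
  let ?J = "{T..<card S}"
  have "L / 2 \<le> (\<Sum>i\<in>S. min 1 (w i * L))" using assms(4) by simp
  also have "\<dots> = (\<Sum>j<card S. min 1 (w (f j) * L))"
    using sum.reindex_bij_betw[OF f, of "\<lambda>i. min 1 (w i * L)"] by simp
  also have "\<dots> \<le> (\<Sum>j<card S. if j < T then 1 else w (f j) * L)"
    by (intro sum_mono) auto
  also have "\<dots> = real (card ({..<card S} \<inter> {..<T})) + (\<Sum>j\<in>?J. w (f j) * L)"
  proof -
    have "{..<card S} \<inter> {j. j < T} = {..<card S} \<inter> {..<T}" "{..<card S} \<inter> - {j. j < T} = ?J"
      by auto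
    then show ?thesis by (simp add: sum.If_cases)
  qed
  also have "card ({..<card S} \<inter> {..<T}) \<le> T"
    using card_mono[of "{..<T}" "{..<card S} \<inter> {..<T}"] by simp
  finally have "L / 2 \<le> real T + (\<Sum>j\<in>?J. w (f j)) * L"
    by (simp add: sum_distrib_right)
  \<comment> \<open>Of the \<open>L / 2\<close> on the left, the first \<open>T\<close> elements
    account for at most \<open>L / 4\<close>.\<close>
  then have "L * (1 / 4) \<le> L * (\<Sum>j\<in>?J. w (f j))"
    using assms(3) by (simp add: mult.commute)
  then have ge: "1 / 4 \<le> (\<Sum>j\<in>?J. w (f j))"
    using assms(2) by (subst (asm) mult_le_cancel_left_pos) auto
  then have "?J \<noteq> {}" by (cases "?J = {}") auto
  then have "(\<Sum>j\<in>?J. w (f j)) < (\<Sum>j\<in>?J. a (Suc j))"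
    using small by (intro sum_strict_mono) auto
  also have "\<dots> = (\<Sum>r\<in>{T<..card S}. a r)"
    by (rule sum.reindex_bij_witness[of _ "\<lambda>r. r - 1" Suc]) auto
  finally show False using ge assms(5) by simp
qed

section \<open>Uniformly random subsets of fixed size\<close>

lemma size_subsets_nonempty:
  assumes "s \<le> CARD('n::finite)"
  shows "size_subsets s \<noteq> ({} :: 'n set set)"
  using obtain_subset_with_card_n[OF assms] by (auto simp: size_subsets_def)

lemma card_size_subsets: "card (size_subsets s :: 'n::finite set set) = CARD('n) choose s"
  using n_subsets[of "UNIV :: 'n set" s] by (simp add: size_subsets_def)

text \<open>The quotient of the two binomials is the product of \<open>(s - i) / (d - i)\<close>
  over \<open>i < r\<close>, and each factor is at most \<open>s / d\<close>.\<close>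

lemma binomial_diff_le:
  assumes "r \<le> s" "s \<le> d"
  shows "real ((d - r) choose (s - r)) \<le> (real s / real d) ^ r * real (d choose s)"
  using assms
proof (induction r)
  case (Suc r)
  have "(s - r) * ((d - r) choose (s - r)) = (d - r) * ((d - Suc r) choose (s - Suc r))"
    using times_binomial_minus1_eq[of "s - r" "d - r"] Suc.prems by simp
  then have "real (s - r) * real ((d - r) choose (s - r)) = real (d - r) * real ((d - Suc r) choose (s - Suc r))"
    by (metis of_nat_mult)
  then have "real ((d - Suc r) choose (s - Suc r)) = real (s - r) / real (d - r) * real ((d - r) choose (s - r))"
    using Suc.prems by (simp add: field_simps)
  also have "\<dots> \<le> (real s / real d) * ((real s / real d) ^ r * real (d choose s))"
  proof (intro mult_mono)
    have "real r * real s \<le> real r * real d" using Suc.prems by (intro mult_left_mono) auto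
    then show "real (s - r) / real (d - r) \<le> real s / real d"
      using Suc.prems by (simp add: field_simps of_nat_diff)
    show "real ((d - r) choose (s - r)) \<le> (real s / real d) ^ r * real (d choose s)"
      using Suc by simp
  qed auto
  finally show ?case by simp
qed simp

lemma prob_superset_le:
  fixes R :: "'n::finite set"
  assumes "s \<le> CARD('n)"
  shows "measure_pmf.prob (pmf_of_set (size_subsets s)) {S. R \<subseteq> S}
    \<le> (real s / real CARD('n)) ^ card R"
proof -
  let ?C = "{S \<in> size_subsets s. R \<subseteq> S}"
  have fin: "finite (size_subsets s :: 'n set set)" by simp
  have pr: "measure_pmf.prob (pmf_of_set (size_subsets s)) {S. R \<subseteq> S}
      = real (card ?C) / real (CARD('n) choose s)"
    by (simp add: measure_pmf_of_set[OF size_subsets_nonempty[OF assms] fin] card_size_subsets Int_def)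
  show ?thesis
  proof (cases "card R \<le> s")
    case False
    then have "?C = {}"
      using card_mono[of _ R] by (fastforce simp: size_subsets_def)
    then show ?thesis using pr by (metis card.empty div_0 of_nat_0 zero_le_divide_iff of_nat_0_le_iff zero_le_power)
  next
    case True
    \<comment> \<open>A superset of \<open>R\<close> is determined by its part outside
      \<open>R\<close>, which turns the count into a binomial coefficient.\<close>
    have "bij_betw (\<lambda>Q. Q \<union> R) {Q. Q \<subseteq> - R \<and> card Q = s - card R} ?C"
    proof (rule bij_betwI[where g = "\<lambda>S. S - R"])
      show "(\<lambda>Q. Q \<union> R) \<in> {Q. Q \<subseteq> - R \<and> card Q = s - card R} \<rightarrow> ?C"
        using True by (auto simp: size_subsets_def card_Un_disjoint disjoint_eq_subset_Compl)
    qed (auto simp: size_subsets_def card_Diff_subset)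
    then have "card ?C = (CARD('n) - card R) choose (s - card R)"
      using n_subsets[of "- R" "s - card R"] by (simp add: bij_betw_same_card[symmetric] Compl_eq_Diff_UNIV card_Diff_subset)
    moreover have "0 < real (CARD('n) choose s)" using assms by simp
    ultimately show ?thesis
      using binomial_diff_le[OF True assms] by (simp add: pr field_simps)
  qed
qed

text \<open>Such an \<open>S\<close> contains some \<open>r\<close>-subset of \<open>H\<close>. A
  union bound over these subsets, of which there are at most \<open>card H ^ r / fact r\<close>,
  suffices.\<close>

lemma prob_card_inter_ge_le:
  fixes H :: "'n::finite set"
  assumes "s \<le> CARD('n)"
  shows "measure_pmf.prob (pmf_of_set (size_subsets s)) {S. r \<le> card (S \<inter> H)}
    \<le> real (card H) ^ r / fact r * (real s / real CARD('n)) ^ r"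
proof -
  let ?M = "measure_pmf (pmf_of_set (size_subsets s)) :: 'n set measure"
  let ?R = "{R. R \<subseteq> H \<and> card R = r}"
  have "measure ?M {S. r \<le> card (S \<inter> H)} \<le> measure ?M (\<Union>R\<in>?R. {S. R \<subseteq> S})"
  proof (intro measure_pmf.finite_measure_mono subsetI)
    fix S assume "S \<in> {S. r \<le> card (S \<inter> H)}"
    then obtain R where "R \<subseteq> S \<inter> H" "card R = r"
      using obtain_subset_with_card_n[of r "S \<inter> H"] by auto
    then show "S \<in> (\<Union>R\<in>?R. {S. R \<subseteq> S})" by auto
  qed simp
  also have "\<dots> \<le> (\<Sum>R\<in>?R. measure ?M {S. R \<subseteq> S})"
    by (intro measure_pmf.finite_measure_subadditive_finite) auto
  also have "\<dots> \<le> (\<Sum>R\<in>?R. (real s / real CARD('n)) ^ r)"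
    using prob_superset_le[OF assms] by (intro sum_mono) force
  also have "\<dots> = real (card H choose r) * (real s / real CARD('n)) ^ r"
    using n_subsets[of H r] by simp
  also have "\<dots> \<le> real (card H) ^ r / fact r * (real s / real CARD('n)) ^ r"
  proof (rule mult_right_mono)
    have "real ((card H choose r) * fact r) \<le> real (card H ^ r)"
      using binomial_fact_pow[of "card H" r] of_nat_le_iff by blast
    then show "real (card H choose r) \<le> real (card H) ^ r / fact r"
      by (simp add: pos_le_divide_eq)
  qed simp
  finally show ?thesis .
qed

text \<open>Markov's inequality for the random weight \<open>sum w S\<close>. Its mean follows by
  linearity from the inclusion probabilities of single elements, the singleton case of
  \<open>prob_superset_le\<close>.\<close>

lemma prob_sum_ge_le:
  fixes w :: "'n::finite \<Rightarrow> real"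
  assumes "s \<le> CARD('n)" and "\<And>i. 0 \<le> w i"
  shows "measure_pmf.prob (pmf_of_set (size_subsets s)) {S. 1 / 2 \<le> sum w S}
    \<le> 2 * sum w UNIV * (real s / real CARD('n))"
proof -
  let ?p = "pmf_of_set (size_subsets s) :: 'n set pmf"
  have fin: "finite (set_pmf ?p)" by (rule finite_subset[OF subset_UNIV]) simp
  have "measure_pmf.prob ?p {S. 1 / 2 \<le> sum w S} \<le> measure_pmf.expectation ?p (sum w) / (1 / 2)"
    using integral_Markov_inequality_measure[of ?p "sum w" "{}" "1 / 2"] fin assms(2)
    by (auto simp: integrable_measure_pmf_finite sum_nonneg)
  also have "measure_pmf.expectation ?p (sum w)
      = measure_pmf.expectation ?p (\<lambda>S. \<Sum>i\<in>UNIV. w i * indicator {S. i \<in> S} S)"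
    by (rule arg_cong[where f = "measure_pmf.expectation ?p"], rule ext)
      (simp add: indicator_def if_distrib sum.If_cases cong: if_cong)
  also have "\<dots> = (\<Sum>i\<in>UNIV. w i * measure_pmf.prob ?p {S. i \<in> S})"
    using fin by (subst Bochner_Integration.integral_sum) (auto simp: integrable_measure_pmf_finite)
  also have "\<dots> \<le> (\<Sum>i\<in>UNIV. w i * (real s / real CARD('n)))"
    using prob_superset_le[OF assms(1), of "{_}"] assms(2) by (intro sum_mono mult_left_mono) auto
  also have "\<dots> = sum w UNIV * (real s / real CARD('n))"
    by (rule sum_distrib_right[symmetric])
  finally show ?thesis by (simp add: mult_ac)
qed

lemma card_ge_threshold_le:
  fixes w :: "'n::finite \<Rightarrow> real"
  assumes "\<And>i. 0 \<le> w i" and "a > 0"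
  shows "real (card {i. a \<le> w i}) \<le> sum w UNIV / a"
proof -
  have "real (card {i. a \<le> w i}) * a = (\<Sum>i\<in>{i. a \<le> w i}. a)" by simp
  also have "\<dots> \<le> (\<Sum>i\<in>{i. a \<le> w i}. w i)" by (intro sum_mono) auto
  also have "\<dots> \<le> sum w UNIV" using assms(1) by (intro sum_mono2) auto
  finally show ?thesis using assms(2) by (simp add: pos_le_divide_eq)
qed

lemma prob_card_inter_threshold_le:
  fixes w :: "'n::finite \<Rightarrow> real"
  assumes "s \<le> CARD('n)" and "\<And>i. 0 \<le> w i" and "sum w UNIV \<le> K" and "a > 0"
  shows "measure_pmf.prob (pmf_of_set (size_subsets s)) {S. r \<le> card (S \<inter> {i. a \<le> w i})}
    \<le> (K / a) ^ r / fact r * (real s / real CARD('n)) ^ r"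
proof -
  have "real (card {i. a \<le> w i}) \<le> K / a"
    using card_ge_threshold_le[of w a] assms by (meson divide_right_mono less_imp_le order_trans)
  then have "real (card {i. a \<le> w i}) ^ r / fact r * (real s / real CARD('n)) ^ r
      \<le> (K / a) ^ r / fact r * (real s / real CARD('n)) ^ r"
    by (intro mult_right_mono divide_right_mono power_mono) auto
  then show ?thesis
    using prob_card_inter_ge_le[OF assms(1), of r "{i. a \<le> w i}"] by linarith
qed

section \<open>Numerical estimates for the third bound\<close>

lemma sum_inverse_squares_tail_le:
  assumes "0 < T"
  shows "(\<Sum>r\<in>{T<..s}. 1 / real r ^ 2) \<le> 1 / real T"
proof -
  have "(\<Sum>r\<in>{T<..s}. 1 / real r ^ 2) \<le> 1 / real T - 1 / real s" if "T \<le> s"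
    using that
  proof (induction s rule: dec_induct)
    case (step m)
    have "0 < m" using assms step.hyps by simp
    \<comment> \<open>This comparison makes the sum telescope.\<close>
    then have "1 / real (Suc m) ^ 2 \<le> 1 / real m - 1 / real (Suc m)"
      by (simp add: divide_simps power2_eq_square)
    moreover have "{T<..Suc m} = insert (Suc m) {T<..m}"
      using step.hyps by auto
    ultimately show ?case using step.IH by simp
  qed simp
  moreover have "1 / real T - 1 / real s \<le> 1 / real T" by simp
  moreover have "(\<Sum>r\<in>{T<..s}. 1 / real r ^ 2) \<le> 1 / real T" if "\<not> T \<le> s"
    using that by simp
  ultimately show ?thesis by (metis order_trans)
qed

text \<open>The number \<open>r ^ r / fact r\<close> is a single term of the exponential series at
  \<open>r\<close>, hence at most \<open>exp 1 ^ r\<close>.\<close>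

lemma inverse_fact_le: "1 / fact r \<le> (3 / real r) ^ r"
proof (cases "r = 0")
  case False
  have "real r ^ r /\<^sub>R fact r \<le> (\<Sum>n. real r ^ n /\<^sub>R fact n)"
    using sum_le_suminf[OF summable_exp_generic[of "real r"], of "{r}"] by simp
  also have "\<dots> = exp 1 ^ r"
    using exp_of_nat_mult[of r "1 :: real"] by (simp add: exp_def)
  also have "\<dots> \<le> 3 ^ r"
    using exp_le by (intro power_mono) auto
  finally show ?thesis
    using False by (simp add: field_simps power_divide)
qed simp

text \<open>At 12 the claim is \<open>12 \<le> exp 3\<close>, which \<open>(5 / 4) ^ 12\<close>
  certifies. Beyond 12 the tangent bound for the remaining factor grows faster than
  \<open>z\<close>.\<close>

lemma self_le_exp_quarter:
  fixes z :: real
  assumes "12 \<le> z"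
  shows "z \<le> exp (z / 4)"
proof -
  have "(5 / 4 :: real) ^ 12 \<le> exp (1 / 4) ^ 12"
    using exp_ge_add_one_self[of "1 / 4 :: real"] by (intro power_mono) auto
  moreover have "exp (1 / 4 :: real) ^ 12 = exp 3"
    by (simp flip: exp_of_nat_mult)
  ultimately have "12 \<le> exp (3 :: real)" by (simp add: power_divide)
  then have "12 * (1 + (z - 12) / 4) \<le> exp 3 * exp ((z - 12) / 4)"
    using assms exp_ge_add_one_self[of "(z - 12) / 4"] by (intro mult_mono) auto
  also have "\<dots> = exp (z / 4)" by (simp add: field_simps flip: exp_add)
  finally show ?thesis using assms by (simp add: field_simps)
qed

text \<open>With \<open>r = n * z\<close> and \<open>z \<ge> 12\<close>, the factor
  \<open>z ^ (2 * n)\<close> is at most \<open>exp (r / 2)\<close>, and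
  \<open>exp (1 / 2) \<le> 5 / 3 = 2 * (5 / 6)\<close>.\<close>

lemma power_Suc_le_geometric:
  assumes "0 < n" and "12 * n \<le> r"
  shows "real r ^ Suc n \<le> (2 * real n) ^ r * (5 / 6) ^ r"
proof -
  have "exp (1 / 2 :: real) ^ 2 = exp 1" by (simp flip: exp_of_nat_mult)
  also have "\<dots> \<le> (5 / 3) ^ 2" using e_less_272 by (simp add: power2_eq_square)
  finally have half: "exp (1 / 2 :: real) \<le> 5 / 3" by (rule power2_le_imp_le) simp
  have "real r ^ Suc n \<le> real r ^ (2 * n)"
    using assms by (intro power_increasing) auto
  also have "\<dots> = real n ^ (2 * n) * (real r / real n) ^ (2 * n)"
    using assms by (simp add: power_divide)
  also have "\<dots> \<le> real n ^ r * exp (real r / real n / 4) ^ (2 * n)"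
    using assms self_le_exp_quarter[of "real r / real n"]
    by (intro mult_mono power_increasing power_mono) (auto simp: field_simps simp flip: of_nat_mult)
  also have "exp (real r / real n / 4) ^ (2 * n) = exp (1 / 2) ^ r"
    using assms by (simp flip: exp_of_nat_mult)
  also have "real n ^ r * exp (1 / 2) ^ r \<le> real n ^ r * (5 / 3) ^ r"
    using half by (intro mult_left_mono power_mono) auto
  also have "\<dots> = (2 * real n) ^ r * (5 / 6) ^ r"
    unfolding power_mult_distrib[symmetric] by (simp add: mult.commute)
  finally show ?thesis .
qed

text \<open>Since \<open>T \<ge> 12 * k * n\<close>, the left side is at most
  \<open>(2 * \<delta> * r / (2 * n)) ^ r\<close>. Of the \<open>r\<close> factors
  \<open>2 * \<delta>\<close>, \<open>Suc n\<close> are kept, and each other one cancels a factor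
  \<open>r\<close> because \<open>2 * \<delta> \<le> 1 / r\<close>. What remains,
  \<open>r ^ Suc n / (2 * n) ^ r\<close>, decays geometrically, so the levels can be summed.\<close>

lemma heavy_level_term_le:
  fixes \<delta> :: real
  assumes "0 < n" and "12 * k * n \<le> T" and "0 < k" and "T < r" and "r \<le> s"
    and "0 \<le> \<delta>" and "2 * \<delta> \<le> 1 / real s"
  shows "(real k / (real T / (4 * real r ^ 2))) ^ r / fact r * \<delta> ^ r
    \<le> (2 * \<delta>) ^ Suc n * (5 / 6) ^ r"
proof -
  have "12 * n \<le> 12 * k * n" using assms(3) by simp
  then have nr: "12 * n \<le> r" "Suc n \<le> r" and r: "0 < r" and T: "0 < T"
    using assms by (linarith, linarith, linarith, metis gr0I mult_is_0 not_le zero_neq_numeral)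
  have "real k * (12 * real n) \<le> real T"
    using assms(2) by (metis mult.assoc mult.commute of_nat_le_iff of_nat_mult of_nat_numeral)
  then have "(real k * (12 * real n)) * real r ^ 2 \<le> real T * real r ^ 2"
    by (rule mult_right_mono) simp
  then have le: "real k / (real T / (4 * real r ^ 2)) \<le> real r ^ 2 / (3 * real n)"
    using assms(1) T by (simp add: field_simps)
  have "2 * \<delta> \<le> 1 / real r"
    using assms(5,7) r by (smt (verit) frac_le of_nat_0_less_iff of_nat_mono)
  then have tail: "(2 * \<delta>) ^ (r - Suc n) \<le> (1 / real r) ^ (r - Suc n)"
    using assms(6) by (intro power_mono) auto
  have "(real k / (real T / (4 * real r ^ 2))) ^ r / fact r * \<delta> ^ r
      \<le> (real r ^ 2 / (3 * real n)) ^ r * (1 / fact r) * \<delta> ^ r"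
    using le assms(6) by (simp add: divide_right_mono mult_right_mono power_mono)
  also have "\<dots> \<le> (real r ^ 2 / (3 * real n)) ^ r * (3 / real r) ^ r * \<delta> ^ r"
    using assms(6) by (intro mult_right_mono mult_left_mono inverse_fact_le) auto
  also have "\<dots> = (2 * \<delta> * real r / (2 * real n)) ^ r"
  proof -
    have "real r ^ 2 / (3 * real n) * (3 / real r) * \<delta> = 2 * \<delta> * real r / (2 * real n)"
      using r by (simp add: power2_eq_square)
    then show ?thesis by (metis power_mult_distrib)
  qed
  also have "\<dots> = (2 * \<delta>) ^ r * real r ^ r / (2 * real n) ^ r"
    by (simp only: power_mult_distrib power_divide)
  also have "\<dots> = (2 * \<delta>) ^ Suc n * ((2 * \<delta>) ^ (r - Suc n) * real r ^ (r - Suc n)) * real r ^ Suc n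
      / (2 * real n) ^ r"
  proof -
    have "z ^ r = z ^ Suc n * z ^ (r - Suc n)" for z :: real
      using nr(2) by (simp only: le_add_diff_inverse flip: power_add)
    from this[of "2 * \<delta>"] this[of "real r"] show ?thesis by (simp only: mult_ac)
  qed
  also have "\<dots> \<le> (2 * \<delta>) ^ Suc n * ((1 / real r) ^ (r - Suc n) * real r ^ (r - Suc n)) * real r ^ Suc n
      / (2 * real n) ^ r"
    using tail assms(6) by (intro divide_right_mono mult_right_mono mult_left_mono) auto
  also have "\<dots> = (2 * \<delta>) ^ Suc n * (real r ^ Suc n / (2 * real n) ^ r)"
    using r by (simp add: power_one_over)
  also have "\<dots> \<le> (2 * \<delta>) ^ Suc n * (5 / 6) ^ r"
    using power_Suc_le_geometric[OF assms(1) nr(1)] assms(1,6)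
    by (intro mult_left_mono) (auto simp: pos_divide_le_eq mult.commute)
  finally show ?thesis .
qed

lemma sum_geometric_five_sixths_le: "finite R \<Longrightarrow> (\<Sum>r\<in>R. (5 / 6 :: real) ^ r) \<le> 6"
  using sum_le_suminf[of "\<lambda>r. (5 / 6 :: real) ^ r" R] suminf_geometric[of "5 / 6 :: real"]
  by (simp add: summable_geometric)

section \<open>Assembly of the three bounds\<close>

theorem theorem1:
  fixes U :: "(real ^ 'n) set" and x :: "real ^ 'n" and d k s :: nat
    and x_tilde x_star :: "'n set \<Rightarrow> real ^ 'n" and t :: real
  assumes "d = CARD('n)"
    and "subspace U" and "dim U = k"
    and "x \<in> U"
    and "s \<in> {1..d}"
    and "\<And>S. S \<in> size_subsets s \<Longrightarrow> corruption S x (x_tilde S)"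
    and "\<And>S. S \<in> size_subsets s \<Longrightarrow> basis_pursuit_solution U (x_tilde S) (x_star S)"
    and "t > 0"
  defines "p \<equiv> measure_pmf.prob (pmf_of_set (size_subsets s)) {S. l1_norm (x_star S - x) \<ge> t}"
  shows "p \<le> 1 / fact (nat \<lfloor>t / 4\<rfloor> + 1) * (12 * real s ^ 2 * real k / real d) ^ (nat \<lfloor>t / 4\<rfloor> + 1)
    \<and> p \<le> 24 * real k * real s / real d
    \<and> (real s \<le> sqrt (real d / 2) \<longrightarrow>
         p \<le> 12 * real k * (2 * real s / real d) ^ (1 + nat \<lfloor>t / (48 * real k)\<rfloor>))"
proof -
  have s: "s \<le> CARD('n)" "0 < s" "0 < d" using assms(1,5) by auto
  obtain w :: "'n \<Rightarrow> real" where w0: "\<And>j. 0 \<le> w j" and wk: "sum w UNIV \<le> real k"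
    and w: "\<And>v j. v \<in> U \<Longrightarrow> \<bar>v $ j\<bar> \<le> w j * l1_norm v"
    using sensitivity_bound[OF assms(2)] assms(3) by metis
  let ?M = "pmf_of_set (size_subsets s) :: 'n set pmf"
  \<comment> \<open>Restricting to \<open>size_subsets s\<close>, the support of the distribution,
    keeps the probability and makes the assumptions on \<open>x_tilde\<close> and
    \<open>x_star\<close> available.\<close>
  define E where "E = {S \<in> size_subsets s. t \<le> l1_norm (x_star S - x)}"
  define \<delta> where "\<delta> = real s / real d"
  define T where "T = nat \<lfloor>t / 4\<rfloor>"
  have \<delta>: "0 \<le> \<delta>" by (simp add: \<delta>_def)
  have T: "real T \<le> t / 4" using assms(8) unfolding T_def by linarith
  have p: "p = measure_pmf.prob ?M E"
    unfolding p_def E_def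
    using measure_Int_set_pmf[of ?M "{S. t \<le> l1_norm (x_star S - x)}"]
    by (simp add: set_pmf_of_set size_subsets_nonempty[OF s(1)] Int_def conj_commute)
  have p_le: "p \<le> measure_pmf.prob ?M F" if "\<And>S. S \<in> E \<Longrightarrow> S \<in> F" for F
    unfolding p using that by (intro measure_pmf.finite_measure_mono) auto
  have err: "l1_norm (x_star S - x) > 0 \<and> real T \<le> l1_norm (x_star S - x) / 4 \<and>
      l1_norm (x_star S - x) \<le> 2 * (\<Sum>i\<in>S. min 1 (w i * l1_norm (x_star S - x)))"
    if "S \<in> E" for S
  proof -
    have S: "S \<in> size_subsets s" "t \<le> l1_norm (x_star S - x)" using that by (auto simp: E_def)
    have "x_star S - x \<in> U"
      using assms(2,4,7) S(1) by (auto simp: basis_pursuit_solution_def subspace_diff)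
    then have "(\<Sum>i\<in>S. min 1 \<bar>(x_star S - x) $ i\<bar>) \<le> (\<Sum>i\<in>S. min 1 (w i * l1_norm (x_star S - x)))"
      by (intro sum_mono min.mono w) auto
    then show ?thesis
      using l1_norm_error_le[OF assms(6,7)[OF S(1)] assms(4)] S(2) T assms(8) by auto
  qed
  have level: "\<exists>r\<in>{T<..s}. r \<le> card (S \<inter> {i. a r \<le> w i})"
    if "S \<in> E" "(\<Sum>r\<in>{T<..s}. a r) \<le> 1 / 4" for S a
    using exists_heavy_level[of S "l1_norm (x_star S - x)" T w a] err[OF that(1)] that
    by (auto simp: E_def size_subsets_def)
  have first: "p \<le> 1 / fact (T + 1) * (12 * real s ^ 2 * real k / real d) ^ (T + 1)"
  proof -
    \<comment> \<open>At most \<open>s\<close> equal thresholds sum to at most \<open>1 / 4\<close>.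
      As the threshold does not depend on \<open>r\<close>, all levels lie in the event of level
      \<open>T + 1\<close>, and no union over \<open>r\<close> is needed.\<close>
    define a where "a = 1 / (4 * real s)"
    have a: "a > 0" using s by (simp add: a_def)
    have "(\<Sum>r\<in>{T<..s}. a) \<le> (\<Sum>r\<in>{0<..s}. a)"
      using a by (intro sum_mono2) auto
    also have "\<dots> = 1 / 4" using s by (simp add: a_def)
    finally have sum_a: "(\<Sum>r\<in>{T<..s}. a) \<le> 1 / 4" .
    have "p \<le> measure_pmf.prob ?M {S. T + 1 \<le> card (S \<inter> {i. a \<le> w i})}"
    proof (rule p_le)
      fix S assume "S \<in> E"
      then obtain r where "r \<in> {T<..s}" "r \<le> card (S \<inter> {i. a \<le> w i})"
        using level[of S "\<lambda>_. a"] sum_a by blast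
      then show "S \<in> {S. T + 1 \<le> card (S \<inter> {i. a \<le> w i})}" by auto
    qed
    also have "\<dots> \<le> (real k / a) ^ (T + 1) / fact (T + 1) * \<delta> ^ (T + 1)"
      unfolding \<delta>_def assms(1) by (rule prob_card_inter_threshold_le[OF s(1) w0 wk a])
    also have "\<dots> = 1 / fact (T + 1) * (real k / a * \<delta>) ^ (T + 1)"
      unfolding power_mult_distrib by (simp only: times_divide_eq_left mult_1_left)
    \<comment> \<open>The base obtained has constant 4, which is relaxed to 12.\<close>
    also have "\<dots> \<le> 1 / fact (T + 1) * (12 * real s ^ 2 * real k / real d) ^ (T + 1)"
      using s by (intro mult_left_mono power_mono)
        (auto simp: a_def \<delta>_def power2_eq_square divide_right_mono mult_right_mono)
    finally show ?thesis .
  qed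
  have markov: "p \<le> 2 * real k * \<delta>"
  proof -
    have "p \<le> measure_pmf.prob ?M {S. 1 / 2 \<le> sum w S}"
    proof (rule p_le)
      fix S assume S: "S \<in> E"
      define L where "L = l1_norm (x_star S - x)"
      have "L \<le> 2 * (\<Sum>i\<in>S. min 1 (w i * L))" using err[OF S] by (simp add: L_def)
      also have "\<dots> \<le> 2 * (\<Sum>i\<in>S. w i * L)"
        by (intro mult_left_mono sum_mono) auto
      also have "\<dots> = 2 * sum w S * L" by (simp add: sum_distrib_right)
      finally have "1 \<le> 2 * sum w S" using err[OF S] by (simp add: L_def)
      then show "S \<in> {S. 1 / 2 \<le> sum w S}" by simp
    qed
    also have "\<dots> \<le> 2 * sum w UNIV * \<delta>"
      using prob_sum_ge_le[OF s(1) w0] by (simp add: \<delta>_def assms(1))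
    also have "\<dots> \<le> 2 * real k * \<delta>"
      using wk \<delta> by (intro mult_right_mono) auto
    finally show ?thesis .
  qed
  have "2 * real k * \<delta> \<le> 24 * real k * \<delta>"
    using \<delta> by (intro mult_right_mono) auto
  with markov have second: "p \<le> 24 * real k * \<delta>" by linarith
  have third: "p \<le> 12 * real k * (2 * \<delta>) ^ (1 + n)"
    if small: "real s \<le> sqrt (real d / 2)" and n_def: "n = nat \<lfloor>t / (48 * real k)\<rfloor>" for n
  proof (cases "n = 0")
    \<comment> \<open>This case includes \<open>k = 0\<close>, where division by zero gives 0. The
      exponent is 1, and the claim is exactly the second bound.\<close>
    case True
    then show ?thesis using second by simp
  next
    case False
    then have n: "0 < n" and k: "0 < k" by (auto simp: n_def intro: gr0I)
    have "real n \<le> t / (48 * real k)" using assms(8) by (simp add: n_def del: le_divide_eq_numeral1)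
    then have "real (12 * k * n) \<le> t / 4" using k by (simp add: field_simps)
    then have kT: "12 * k * n \<le> T" unfolding T_def by linarith
    then have T0: "0 < T" using n k by (metis gr0I mult_is_0 not_le zero_neq_numeral)
    \<comment> \<open>The assumption on \<open>s\<close> amounts to
      \<open>2 * s ^ 2 \<le> d\<close>, that is, \<open>2 * \<delta> \<le> 1 / s\<close>.\<close>
    have "real s ^ 2 \<le> real d / 2"
      using small by (metis of_nat_0_le_iff real_sqrt_ge_0_iff real_le_rsqrt real_sqrt_le_iff real_sqrt_abs abs_of_nat)
    then have \<delta>s: "2 * \<delta> \<le> 1 / real s"
      using s by (simp add: \<delta>_def field_simps power2_eq_square)
    \<comment> \<open>The inverse squares beyond \<open>T\<close> sum to at most
      \<open>1 / T\<close>, so this scaling makes the thresholds sum to at most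
      \<open>1 / 4\<close>.\<close>
    define a where "a r = real T / (4 * real r ^ 2)" for r
    have "(\<Sum>r\<in>{T<..s}. a r) = real T / 4 * (\<Sum>r\<in>{T<..s}. 1 / real r ^ 2)"
      by (simp add: a_def sum_distrib_left)
    also have "\<dots> \<le> real T / 4 * (1 / real T)"
      by (intro mult_left_mono sum_inverse_squares_tail_le T0) simp
    finally have sum_a: "(\<Sum>r\<in>{T<..s}. a r) \<le> 1 / 4" using T0 by simp
    have "p \<le> measure_pmf.prob ?M (\<Union>r\<in>{T<..s}. {S. r \<le> card (S \<inter> {i. a r \<le> w i})})"
      by (rule p_le) (use level[OF _ sum_a] in auto)
    also have "\<dots> \<le> (\<Sum>r\<in>{T<..s}. measure_pmf.prob ?M {S. r \<le> card (S \<inter> {i. a r \<le> w i})})"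
      by (intro measure_pmf.finite_measure_subadditive_finite) auto
    also have "\<dots> \<le> (\<Sum>r\<in>{T<..s}. (2 * \<delta>) ^ Suc n * (5 / 6) ^ r)"
    proof (rule sum_mono)
      fix r assume r: "r \<in> {T<..s}"
      have "measure_pmf.prob ?M {S. r \<le> card (S \<inter> {i. a r \<le> w i})}
          \<le> (real k / a r) ^ r / fact r * \<delta> ^ r"
        using prob_card_inter_threshold_le[OF s(1) w0 wk, of "a r" r] r T0
        by (simp add: a_def \<delta>_def assms(1))
      also have "\<dots> \<le> (2 * \<delta>) ^ Suc n * (5 / 6) ^ r"
        unfolding a_def using r by (intro heavy_level_term_le[OF n kT k _ _ \<delta> \<delta>s]) auto
      finally show "measure_pmf.prob ?M {S. r \<le> card (S \<inter> {i. a r \<le> w i})}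
          \<le> (2 * \<delta>) ^ Suc n * (5 / 6) ^ r" .
    qed
    also have "\<dots> = (2 * \<delta>) ^ Suc n * (\<Sum>r\<in>{T<..s}. (5 / 6) ^ r)"
      by (rule sum_distrib_left[symmetric])
    also have "\<dots> \<le> (2 * \<delta>) ^ Suc n * (12 * real k)"
    proof (rule mult_left_mono)
      \<comment> \<open>The geometric series contributes 6, absorbed because
        \<open>k \<ge> 1\<close>.\<close>
      have "6 \<le> 12 * real k" using k by simp
      then show "(\<Sum>r\<in>{T<..s}. (5 / 6 :: real) ^ r) \<le> 12 * real k"
        using sum_geometric_five_sixths_le[of "{T<..s}"] by simp
    qed (use \<delta> in simp)
    finally show ?thesis by (simp only: mult.commute plus_1_eq_Suc)
  qed
  show ?thesis
    using first second third[OF _ refl] unfolding T_def \<delta>_def times_divide_eq_right by blast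
qed

end
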